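(* Let $\mathcal F$ be a function ring over a field $K$ and let $F$ be a set of polynomials in $\mathcal F\setminus\{o\}$. Then $F$ is a Gröbner basis of $\mathrm{ideal}(F)$ if and only if (1) for all $f\in F$ and all monomials $m,l\in M(\mathcal F)$ we have $m\star f\star l\stackrel{*}{\longrightarrow}_F o$, and (2) for all $p,q\in F$ (not necessarily different) and every tuple $(t,u_1,u_2,v_1,v_2)\in\mathcal C_s(p,q)$ we have $\mathrm{spol}(p,q,t,u_1,u_2,v_1,v_2)\stackrel{*}{\longrightarrow}_F o$.
   Context: Function ring: $T$ is a set, $K$ a field, and $\mathcal F$ is the set of functions $f:T\to K$ with finite support $\mathrm{supp}(f)$; $\mathcal F$ has pointwise addition, zero function $o$, scalar multiplication $(\alpha\cdot f)(t)=(f\cdot\alpha)(t)=\alpha f(t)$, and a multiplication $\star:\mathcal F\times\mathcal F\to\mathcal F$ making it an associative ring (not necessarily with unit) such that $(\alpha\cdot f)\star g=\alpha\cdot(f\star g)$ and $f\star(g\cdot\alpha)=(f\star g)\cdot\alpha$. Elements of $\mathcal F$ are called polynomials. $M(\mathcal F)$ is the set of monomials (functions with one-element support); monomials with coefficient $1$ are identified with elements of $T$ (terms). $\mathrm{ideal}(F)=\{\sum_{i=1}^n g_i\star f_i\star h_i\mid f_i\in F,\ g_i,h_i\in\mathcal F,\ n\in\mathbb N\}$. $\succeq$ is a fixed total well-founded ordering on $T$. For $f\ne o$, $\operatorname{HT}(f)$ is the $\succeq$-largest element of $\mathrm{supp}(f)$, $\operatorname{HC}(f)=f(\operatorname{HT}(f))$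 and $\operatorname{HM}(f)=\operatorname{HC}(f)\cdot\operatorname{HT}(f)$. An inequality $t\succ\operatorname{HT}(h)$ is regarded as satisfied if $h=o$; an equality $\operatorname{HT}(h)=t$ presupposes $h\ne o$. $\geq$ is a fixed reductive restriction of $\succeq$: a partial well-founded ordering on $T$ such that $t\ge s$ implies $t\succeq s$, and such that for $t,t_1,t_2,w_1,w_2\in T$: if $t_2\ge t_1$, $t_1\succ t$ and $t_2=\operatorname{HT}(w_1\star t_1\star w_2)$, then $t_2\succ\operatorname{HT}(w_1\star t\star w_2)$. Reduction: for non-zero $f,p$, $p\longrightarrow_f q$ (at a monomial $\alpha\cdot t$) if there are $m,l\in M(\mathcal F)$ with $t\in\mathrm{supp}(p)$, $p(t)=\alpha$, $\operatorname{HT}(m\star\operatorname{HT}(f)\star l)=\operatorname{HT}(m\star f\star l)=t\ge\operatorname{HT}(f)$, $\operatorname{HM}(m\star f\star l)=\alpha\cdot t$ and $q=p-m\star f\star l$. $\longrightarrow_F=\bigcup_{f\in F}\longrightarrow_f$; $\stackrel{*}{\longrightarrow}_F$ and $\stackrel{*}{\longleftrightarrow}_F$ are its reflexive transitive and reflexive symmetric transitive closures. $F$ is a Gröbner basis of $\mathfrak i=\mathrm{ideal}(F)$ if $\stackrel{*}{\longleftrightarrow}_F$ equals the congruence $\equiv_{\mathfrak i}$ ($f\equiv_{\mathfrak i}g$ iff $f-g\in\mathfrak i$) and $\longrightarrow_F$ is confluent. For non-zero $p,q$: $\mathcal C_s(p,q)$ is the set of $(t,u_1,u_2,v_1,v_2)\in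 T^5$ with $\operatorname{HT}(u_1\star p\star v_1)=\operatorname{HT}(u_1\star\operatorname{HT}(p)\star v_1)=t=\operatorname{HT}(u_2\star q\star v_2)=\operatorname{HT}(u_2\star\operatorname{HT}(q)\star v_2)$, $\operatorname{HT}(p)\le t$ and $\operatorname{HT}(q)\le t$; and $\mathrm{spol}(p,q,t,u_1,u_2,v_1,v_2)=\operatorname{HC}(u_1\star p\star v_1)^{-1}\cdot u_1\star p\star v_1-\operatorname{HC}(u_2\star q\star v_2)^{-1}\cdot u_2\star q\star v_2$. *)

theory Defs
  imports
    "HOL-Library.Poly_Mapping"
    "HOL-Library.Confluence"
begin

text \<open>
  Polynomials are finitely supported functions of type \<open>'t \<Rightarrow>\<^sub>0 'k\<close>. The multiplication \<open>star\<close> is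
  an explicit parameter; it is unrelated to the convolution product that \<open>Poly_Mapping\<close>
  provides when \<open>'t\<close> is a monoid.

  Orderings are reflexive relations of type \<open>'t rel\<close>: \<open>(s, t) \<in> tord\<close> means $s \preceq t$ and
  \<open>(s, t) \<in> rord\<close> means $s \leq t$, so \<open>(s, t) \<in> tord - Id\<close> means $s \prec t$.
\<close>

definition cmul :: "'k::field \<Rightarrow> ('t \<Rightarrow>\<^sub>0 'k) \<Rightarrow> ('t \<Rightarrow>\<^sub>0 'k)" where
  "cmul \<alpha> f = Poly_Mapping.map (\<lambda>c. \<alpha> * c) f"

definition monomials :: "('t \<Rightarrow>\<^sub>0 'k::field) set" where
  "monomials = {m. is_singleton (Poly_Mapping.keys m)}"

abbreviation mon :: "'t \<Rightarrow> ('t \<Rightarrow>\<^sub>0 'k::field)" where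
  "mon t \<equiv> Poly_Mapping.single t 1"

locale function_ring =
  fixes star :: "('t \<Rightarrow>\<^sub>0 'k::field) \<Rightarrow> ('t \<Rightarrow>\<^sub>0 'k) \<Rightarrow> ('t \<Rightarrow>\<^sub>0 'k)" (infixl \<open>\<star>\<close> 70)
  assumes star_assoc: "(f \<star> g) \<star> h = f \<star> (g \<star> h)"
    and star_distrib_right: "(f + g) \<star> h = f \<star> h + g \<star> h"
    and star_distrib_left: "f \<star> (g + h) = f \<star> g + f \<star> h"
    and cmul_star_left: "cmul \<alpha> f \<star> g = cmul \<alpha> (f \<star> g)"
    and cmul_star_right: "f \<star> cmul \<alpha> g = cmul \<alpha> (f \<star> g)"


subsection \<open>Head terms\<close>

text \<open>\<open>HT\<close>, \<open>HC\<close> and \<open>HM\<close> are meaningful for nonzero arguments only.\<close>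

definition HT :: "'t rel \<Rightarrow> ('t \<Rightarrow>\<^sub>0 'k::field) \<Rightarrow> 't" where
  "HT tord f = (THE t. t \<in> Poly_Mapping.keys f \<and> (\<forall>s \<in> Poly_Mapping.keys f. (s, t) \<in> tord))"

definition HC :: "'t rel \<Rightarrow> ('t \<Rightarrow>\<^sub>0 'k::field) \<Rightarrow> 'k" where
  "HC tord f = Poly_Mapping.lookup f (HT tord f)"

definition HM :: "'t rel \<Rightarrow> ('t \<Rightarrow>\<^sub>0 'k::field) \<Rightarrow> ('t \<Rightarrow>\<^sub>0 'k)" where
  "HM tord f = cmul (HC tord f) (mon (HT tord f))"

text \<open>
  Two conventions on the zero polynomial: an equality $HT(h) = t$ presupposes that \<open>h\<close> is nonzero,
  whereas an inequality $t \succ HT(h)$ counts as satisfied if \<open>h\<close> is zero.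
\<close>

definition HT_eq :: "'t rel \<Rightarrow> ('t \<Rightarrow>\<^sub>0 'k::field) \<Rightarrow> 't \<Rightarrow> bool" where
  "HT_eq tord h t \<longleftrightarrow> h \<noteq> 0 \<and> HT tord h = t"

definition HT_less :: "'t rel \<Rightarrow> ('t \<Rightarrow>\<^sub>0 'k::field) \<Rightarrow> 't \<Rightarrow> bool" where
  "HT_less tord h t \<longleftrightarrow> h = 0 \<or> (HT tord h, t) \<in> tord - Id"

locale reductive_function_ring = function_ring star
  for star :: "('t \<Rightarrow>\<^sub>0 'k::field) \<Rightarrow> ('t \<Rightarrow>\<^sub>0 'k) \<Rightarrow> ('t \<Rightarrow>\<^sub>0 'k)" (infixl \<open>\<star>\<close> 70) +
  fixes tord rord :: "'t rel"
  assumes tord_well_order: "well_order_on UNIV tord"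
    and rord_partial_order: "partial_order_on UNIV rord"
    and rord_wf: "wf (rord - Id)"
    and rord_subset: "rord \<subseteq> tord"
    and rord_reductive:
      "\<lbrakk>(t1, t2) \<in> rord; (t, t1) \<in> tord - Id; HT_eq tord (mon w1 \<star> mon t1 \<star> mon w2) t2\<rbrakk>
       \<Longrightarrow> HT_less tord (mon w1 \<star> mon t \<star> mon w2) t2"


subsection \<open>Ideals, reduction, Groebner bases and s-polynomials\<close>

context
  fixes star :: "('t \<Rightarrow>\<^sub>0 'k::field) \<Rightarrow> ('t \<Rightarrow>\<^sub>0 'k) \<Rightarrow> ('t \<Rightarrow>\<^sub>0 'k)" (infixl \<open>\<star>\<close> 70)
    and tord rord :: "'t rel"
begin

text \<open>The empty sum is included, so the ideal generated by the empty set is the zero ideal.\<close>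

definition ideal_gen :: "('t \<Rightarrow>\<^sub>0 'k) set \<Rightarrow> ('t \<Rightarrow>\<^sub>0 'k) set" where
  "ideal_gen F = {(\<Sum>i<n. g i \<star> f i \<star> h i) | (n::nat) g f h. \<forall>i<n. f i \<in> F}"

definition red1 :: "('t \<Rightarrow>\<^sub>0 'k) \<Rightarrow> ('t \<Rightarrow>\<^sub>0 'k) \<Rightarrow> ('t \<Rightarrow>\<^sub>0 'k) \<Rightarrow> bool" where
  "red1 f p q \<longleftrightarrow> f \<noteq> 0 \<and> p \<noteq> 0 \<and>
    (\<exists>t \<alpha>. \<exists>m \<in> monomials. \<exists>l \<in> monomials.
      t \<in> Poly_Mapping.keys p \<and> Poly_Mapping.lookup p t = \<alpha> \<and>
      HT_eq tord (m \<star> mon (HT tord f) \<star> l) t \<and>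
      HT_eq tord (m \<star> f \<star> l) t \<and>
      (HT tord f, t) \<in> rord \<and>
      HM tord (m \<star> f \<star> l) = cmul \<alpha> (mon t) \<and>
      q = p - m \<star> f \<star> l)"

definition red :: "('t \<Rightarrow>\<^sub>0 'k) set \<Rightarrow> ('t \<Rightarrow>\<^sub>0 'k) \<Rightarrow> ('t \<Rightarrow>\<^sub>0 'k) \<Rightarrow> bool" where
  "red F p q \<longleftrightarrow> (\<exists>f \<in> F. red1 f p q)"

definition groebner_basis :: "('t \<Rightarrow>\<^sub>0 'k) set \<Rightarrow> bool" where
  "groebner_basis F \<longleftrightarrow>
    (\<forall>f g. equivclp (red F) f g \<longleftrightarrow> f - g \<in> ideal_gen F) \<and> confluentp (red F)"

definition critical_tuples :: "('t \<Rightarrow>\<^sub>0 'k) \<Rightarrow> ('t \<Rightarrow>\<^sub>0 'k) \<Rightarrow> ('t \<times> 't \<times> 't \<times> 't \<times> 't) set" where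
  "critical_tuples p q = {(t, u1, u2, v1, v2).
    HT_eq tord (mon u1 \<star> p \<star> mon v1) t \<and>
    HT_eq tord (mon u1 \<star> mon (HT tord p) \<star> mon v1) t \<and>
    HT_eq tord (mon u2 \<star> q \<star> mon v2) t \<and>
    HT_eq tord (mon u2 \<star> mon (HT tord q) \<star> mon v2) t \<and>
    (HT tord p, t) \<in> rord \<and> (HT tord q, t) \<in> rord}"

definition spol ::
  "('t \<Rightarrow>\<^sub>0 'k) \<Rightarrow> ('t \<Rightarrow>\<^sub>0 'k) \<Rightarrow> 't \<times> 't \<times> 't \<times> 't \<times> 't \<Rightarrow> ('t \<Rightarrow>\<^sub>0 'k)" where
  "spol p q = (\<lambda>(t, u1, u2, v1, v2).
    cmul (inverse (HC tord (mon u1 \<star> p \<star> mon v1))) (mon u1 \<star> p \<star> mon v1) -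
    cmul (inverse (HC tord (mon u2 \<star> q \<star> mon v2))) (mon u2 \<star> q \<star> mon v2))"

end

end

theory Submission
  imports Defs "HOL-Library.Multiset"
begin

text \<open>
  A step \<^term>\<open>red star tord rord F\<close> subtracts a monomial multiple \<open>m \<star> f \<star> l\<close> that cancels one
  term and alters only smaller ones, so reduction terminates and confluence is a local matter.
  Reduction is also compatible with differences: if \<open>p - q\<close> reduces to zero, then \<open>p\<close> and \<open>q\<close>
  have a common reduct. For a local divergence the difference of the two reducts is either a
  multiple of an s-polynomial, when the same term is cancelled, or reduces to zero in two steps.
  Condition (1) makes \<open>p\<close> and \<open>p + m \<star> f \<star> l\<close> joinable, which yields the whole ideal congruence.
\<close>

section \<open>Induction on finitely supported functions, and Newman's lemma\<close>

lemma poly_mapping_single_add_induct [case_names zero single_add]: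
  fixes f :: "'a \<Rightarrow>\<^sub>0 'b::comm_monoid_add"
  assumes "P 0"
    and "\<And>a b f. b \<noteq> 0 \<Longrightarrow> P f \<Longrightarrow> P (Poly_Mapping.single a b + f)"
  shows "P f"
proof (induction f rule: update_induct)
  case const
  show ?case by (fact assms(1))
next
  case (update f a b)
  \<comment> \<open>The key \<open>a\<close> is new, so \<open>f\<close> has coefficient 0 there and
    overwriting agrees with adding.\<close>
  have "Poly_Mapping.update a b f = Poly_Mapping.single a b + f"
    using update(1)
    by (intro poly_mapping_eqI) (auto simp: lookup_update lookup_add lookup_single in_keys_iff when_def)
  with update assms(2) show ?case by simp
qed

text \<open>Newman's lemma, by well-founded induction on the source \<open>x\<close> of the fork:
  local confluence is applied only to the first steps, and the induction hypothesis to their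
  targets.\<close>

lemma newman:
  assumes wf: "wfP r\<inverse>\<inverse>"
    and local: "\<And>x y z. r x y \<Longrightarrow> r x z \<Longrightarrow> \<exists>u. r\<^sup>*\<^sup>* y u \<and> r\<^sup>*\<^sup>* z u"
  shows "confluentp r"
proof (rule confluentpI)
  fix x y z
  assume "r\<^sup>*\<^sup>* x y" "r\<^sup>*\<^sup>* x z"
  with wf show "\<exists>u. r\<^sup>*\<^sup>* y u \<and> r\<^sup>*\<^sup>* z u"
  proof (induction x arbitrary: y z rule: wfp_induct_rule)
    case (less x)
    show ?case
    proof (cases "x = y \<or> x = z")
      case True
      with less.prems show ?thesis by blast
    next
      case False
      obtain y' where y': "r x y'" "r\<^sup>*\<^sup>* y' y"
        using less.prems(1) False by (cases rule: converse_rtranclpE) auto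
      obtain z' where z': "r x z'" "r\<^sup>*\<^sup>* z' z"
        using less.prems(2) False by (cases rule: converse_rtranclpE) auto
      \<comment> \<open>The diagram is tiled from \<open>u\<close>, which closes the local fork;
        \<open>v\<close> then joins \<open>y\<close> with \<open>u\<close>, and \<open>w\<close>
        joins \<open>v\<close> with \<open>z\<close>.\<close>
      obtain u where u: "r\<^sup>*\<^sup>* y' u" "r\<^sup>*\<^sup>* z' u" using local[OF y'(1) z'(1)] by blast
      obtain v where v: "r\<^sup>*\<^sup>* y v" "r\<^sup>*\<^sup>* u v" using less.IH[OF _ y'(2) u(1)] y'(1) by auto
      have "r\<^sup>*\<^sup>* z' v" using u(2) v(2) by (rule rtranclp_trans)
      then obtain w where "r\<^sup>*\<^sup>* v w" "r\<^sup>*\<^sup>* z w" using less.IH[OF _ _ z'(2)] z'(1) by blast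
      with v(1) show ?thesis by (blast intro: rtranclp_trans)
    qed
  qed
qed

subsection \<open>Scalar multiples and head terms\<close>

lemma lookup_cmul [simp]: "Poly_Mapping.lookup (cmul a f) t = a * Poly_Mapping.lookup f t"
  by (simp add: cmul_def map.rep_eq when_def)

lemma keys_cmul: "a \<noteq> 0 \<Longrightarrow> Poly_Mapping.keys (cmul a f) = Poly_Mapping.keys f"
  by (auto simp: in_keys_iff)

lemma cmul_eq_0_iff: "cmul a f = 0 \<longleftrightarrow> a = 0 \<or> f = 0"
  by (auto simp: poly_mapping_eq_iff fun_eq_iff)

lemma cmul_cmul: "cmul a (cmul b f) = cmul (a * b) f"
  by (rule poly_mapping_eqI) (simp add: mult.assoc)

lemma cmul_1 [simp]: "cmul 1 f = f"
  by (rule poly_mapping_eqI) simp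

lemma cmul_diff: "cmul a (f - g) = cmul a f - cmul a g"
  by (rule poly_mapping_eqI) (simp add: lookup_minus algebra_simps)

lemma cmul_mon: "cmul a (mon t) = Poly_Mapping.single t a"
  by (rule poly_mapping_eqI) (simp add: lookup_single when_def)

lemma HT_cmul: "a \<noteq> 0 \<Longrightarrow> HT tord (cmul a f) = HT tord f"
  by (simp add: HT_def keys_cmul)

lemma HT_eq_cmul: "a \<noteq> 0 \<Longrightarrow> HT_eq tord (cmul a f) t \<longleftrightarrow> HT_eq tord f t"
  by (simp add: HT_eq_def HT_cmul cmul_eq_0_iff)

lemma HM_eq_iff:
  assumes "HT_eq tord h t"
  shows "HM tord h = cmul a (mon t) \<longleftrightarrow> Poly_Mapping.lookup h t = a"
  using assms by (auto simp: HM_def HC_def HT_eq_def cmul_mon) (metis lookup_single_eq)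

lemma monomials_eq: "monomials = {Poly_Mapping.single t a |t a. a \<noteq> (0::'k::field)}"
proof (intro subset_antisym subsetI)
  fix m :: "'t \<Rightarrow>\<^sub>0 'k" assume "m \<in> monomials"
  then obtain t where t: "Poly_Mapping.keys m = {t}"
    by (auto simp: monomials_def is_singleton_def)
  have "m = Poly_Mapping.single t (Poly_Mapping.lookup m t)"
    using t by (intro poly_mapping_eqI) (auto simp: lookup_single when_def in_keys_iff set_eq_iff)
  with t show "m \<in> {Poly_Mapping.single t a |t a. a \<noteq> 0}"
    by (metis (mono_tags, lifting) in_keys_iff mem_Collect_eq singletonI)
qed (auto simp: monomials_def)

lemma cmul_monomial: "m \<in> monomials \<Longrightarrow> a \<noteq> 0 \<Longrightarrow> cmul a m \<in> monomials"
  by (simp add: monomials_def keys_cmul)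

lemma monomialE:
  assumes "m \<in> monomials"
  obtains a t where "a \<noteq> 0" "m = cmul a (mon t)"
  using assms by (auto simp: monomials_eq cmul_mon)

context reductive_function_ring
begin

lemma star_0_left [simp]: "0 \<star> f = 0"
  using star_distrib_right[of 0 0 f] by simp

lemma star_0_right [simp]: "f \<star> 0 = 0"
  using star_distrib_left[of f 0 0] by simp

text \<open>A finite nonempty support has a greatest element in a linear order, and antisymmetry
  makes it unique; hence the description defining \<open>HT\<close> denotes for nonzero
  \<open>f\<close>.\<close>

lemma HT_greatest:
  assumes "f \<noteq> 0"
  shows "HT tord f \<in> Poly_Mapping.keys f"
    and "s \<in> Poly_Mapping.keys f \<Longrightarrow> (s, HT tord f) \<in> tord"
proof -
  have lin: "linear_order tord"
    using tord_well_order by (simp add: well_order_on_def)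
  have "\<exists>t\<in>A. \<forall>s\<in>A. (s, t) \<in> tord" if "finite A" "A \<noteq> {}" for A
    using that
  proof (induction A rule: finite_ne_induct)
    case (singleton x)
    then show ?case using lin by (auto simp: order_on_defs refl_on_def)
  next
    case (insert x A)
    then obtain t where t: "t \<in> A" "\<forall>s\<in>A. (s, t) \<in> tord" by blast
    have "(x, t) \<in> tord \<or> (t, x) \<in> tord"
      using lin by (auto simp: order_on_defs refl_on_def total_on_def) metis
    moreover have "(x, x) \<in> tord" using lin by (auto simp: order_on_defs refl_on_def)
    moreover have "trans tord" using lin by (auto simp: order_on_defs)
    ultimately show ?case using t by (blast dest: transD)
  qed
  moreover have "Poly_Mapping.keys f \<noteq> {}" using assms by simp
  ultimately obtain t where "t \<in> Poly_Mapping.keys f" "\<forall>s\<in>Poly_Mapping.keys f. (s, t) \<in> tord"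
    using finite_keys[of f] by blast
  moreover have "antisym tord" using lin by (auto simp: order_on_defs)
  ultimately have "HT tord f = t"
    unfolding HT_def by (intro the_equality) (auto dest: antisymD)
  with \<open>t \<in> _\<close> \<open>\<forall>s\<in>_. _\<close> show "HT tord f \<in> Poly_Mapping.keys f"
    and "s \<in> Poly_Mapping.keys f \<Longrightarrow> (s, HT tord f) \<in> tord" by blast+
qed

lemma HT_eq_imp_lookup_nonzero: "HT_eq tord h t \<Longrightarrow> Poly_Mapping.lookup h t \<noteq> 0"
  using HT_greatest(1) by (auto simp: HT_eq_def in_keys_iff)

subsection \<open>Reducing multiples\<close>

text \<open>Collects the part of a reduction step that does not mention the polynomial being
  reduced, so that one multiple \<open>h\<close> can act on several polynomials at the term
  \<open>t\<close>.\<close>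

definition reducer :: "('t \<Rightarrow>\<^sub>0 'k) set \<Rightarrow> 't \<Rightarrow> ('t \<Rightarrow>\<^sub>0 'k) \<Rightarrow> bool" where
  "reducer F t h \<longleftrightarrow> (\<exists>f\<in>F. f \<noteq> 0 \<and> (\<exists>m\<in>monomials. \<exists>l\<in>monomials.
    h = m \<star> f \<star> l \<and> HT_eq tord (m \<star> mon (HT tord f) \<star> l) t \<and> HT_eq tord h t \<and>
    (HT tord f, t) \<in> rord))"

text \<open>With \<open>t\<close> the head term of \<open>h\<close>, the condition on
  \<open>HM\<close> compares a single coefficient. That coefficient is nonzero in \<open>h\<close>,
  which already forces \<open>t\<close> into the support of \<open>p\<close> and \<open>p\<close> to
  be nonzero.\<close>

lemma red_iff:
  "red star tord rord F p q \<longleftrightarrow> (\<exists>t h. reducer F t h \<and>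
    Poly_Mapping.lookup h t = Poly_Mapping.lookup p t \<and> q = p - h)"
proof
  assume "red star tord rord F p q"
  then show "\<exists>t h. reducer F t h \<and> Poly_Mapping.lookup h t = Poly_Mapping.lookup p t \<and> q = p - h"
    unfolding red_def red1_def reducer_def by (metis HM_eq_iff)
next
  assume "\<exists>t h. reducer F t h \<and> Poly_Mapping.lookup h t = Poly_Mapping.lookup p t \<and> q = p - h"
  then obtain t f m l where *: "f \<in> F" "f \<noteq> 0" "m \<in> monomials" "l \<in> monomials"
    "HT_eq tord (m \<star> mon (HT tord f) \<star> l) t" "HT_eq tord (m \<star> f \<star> l) t" "(HT tord f, t) \<in> rord"
    "Poly_Mapping.lookup (m \<star> f \<star> l) t = Poly_Mapping.lookup p t" "q = p - m \<star> f \<star> l"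
    unfolding reducer_def by blast
  then have "t \<in> Poly_Mapping.keys p"
    by (metis HT_eq_imp_lookup_nonzero in_keys_iff)
  moreover from this have "p \<noteq> 0" by auto
  moreover have "HM tord (m \<star> f \<star> l) = cmul (Poly_Mapping.lookup p t) (mon t)"
    using *(6,8) by (simp add: HM_eq_iff)
  ultimately show "red star tord rord F p q"
    using * unfolding red_def red1_def by blast
qed

lemma reducer_HT_eq: "reducer F t h \<Longrightarrow> HT_eq tord h t"
  by (auto simp: reducer_def)

lemma reducer_lookup_nonzero: "reducer F t h \<Longrightarrow> Poly_Mapping.lookup h t \<noteq> 0"
  by (rule HT_eq_imp_lookup_nonzero[OF reducer_HT_eq])

text \<open>The scalar is absorbed by the left monomial factor, and nonzero scalars do not move head
  terms.\<close>

lemma reducer_cmul: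
  assumes "reducer F t h" "a \<noteq> 0"
  shows "reducer F t (cmul a h)"
proof -
  from assms obtain f m l where *: "f \<in> F" "f \<noteq> 0" "m \<in> monomials" "l \<in> monomials"
    "h = m \<star> f \<star> l" "HT_eq tord (m \<star> mon (HT tord f) \<star> l) t" "HT_eq tord h t" "(HT tord f, t) \<in> rord"
    by (auto simp: reducer_def)
  have "cmul a h = cmul a m \<star> f \<star> l"
    and "HT_eq tord (cmul a m \<star> mon (HT tord f) \<star> l) t" "HT_eq tord (cmul a h) t"
    using * assms(2) by (simp_all add: cmul_star_left HT_eq_cmul)
  with * cmul_monomial[OF *(3) assms(2)] show ?thesis
    unfolding reducer_def by blast
qed

lemma reducer_red_0: "reducer F t h \<Longrightarrow> red star tord rord F h 0"
  unfolding red_iff by force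

text \<open>The reflexive closure covers the case where \<open>t\<close> does not occur in
  \<open>p\<close> and nothing is subtracted. This uniform form lets the same \<open>h\<close> be
  applied to any polynomial.\<close>

lemma red_step:
  assumes "reducer F t h" "Poly_Mapping.lookup h t = 1"
  shows "(red star tord rord F)\<^sup>=\<^sup>= p (p - cmul (Poly_Mapping.lookup p t) h)"
proof (cases "Poly_Mapping.lookup p t = 0")
  case True
  then show ?thesis by (simp add: cmul_eq_0_iff[THEN iffD2])
next
  case False
  with assms have "red star tord rord F p (p - cmul (Poly_Mapping.lookup p t) h)"
    unfolding red_iff by (intro exI[of _ t] exI[of _ "cmul (Poly_Mapping.lookup p t) h"])
      (simp add: reducer_cmul)
  then show ?thesis by simp
qed

lemma red_normE:
  assumes "red star tord rord F p q"
  obtains t h where "reducer F t h" "Poly_Mapping.lookup h t = 1"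
    "Poly_Mapping.lookup p t \<noteq> 0" "q = p - cmul (Poly_Mapping.lookup p t) h"
proof -
  from assms obtain t h where h: "reducer F t h"
    "Poly_Mapping.lookup h t = Poly_Mapping.lookup p t" "q = p - h"
    by (auto simp: red_iff)
  let ?a = "Poly_Mapping.lookup p t"
  have nz: "?a \<noteq> 0" using h reducer_lookup_nonzero by metis
  with h have "reducer F t (cmul (inverse ?a) h)" by (simp add: reducer_cmul)
  moreover have "q = p - cmul ?a (cmul (inverse ?a) h)" using h nz by (simp add: cmul_cmul)
  ultimately show thesis using h nz by (intro that) auto
qed

section \<open>Compatibility of reduction with scalars and differences, and termination\<close>

lemma red_cmul:
  assumes "red star tord rord F p q" "a \<noteq> 0"
  shows "red star tord rord F (cmul a p) (cmul a q)"
proof -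
  from assms obtain t h where "reducer F t h"
    "Poly_Mapping.lookup h t = Poly_Mapping.lookup p t" "q = p - h"
    by (auto simp: red_iff)
  with assms show ?thesis unfolding red_iff
    by (intro exI[of _ t] exI[of _ "cmul a h"]) (simp add: reducer_cmul cmul_diff)
qed

lemma rtranclp_red_cmul_0:
  assumes "(red star tord rord F)\<^sup>*\<^sup>* p 0"
  shows "(red star tord rord F)\<^sup>*\<^sup>* (cmul a p) 0"
proof (cases "a = 0")
  case True
  then show ?thesis by (simp add: cmul_eq_0_iff[THEN iffD2])
next
  case False
  show ?thesis using assms
  proof (induction rule: converse_rtranclp_induct)
    case base
    then show ?case by (simp add: cmul_eq_0_iff[THEN iffD2])
  next
    case (step p q)
    then show ?case by (meson False red_cmul converse_rtranclp_into_rtranclp)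
  qed
qed

text \<open>A normalised \<open>h\<close> that cancels \<open>t\<close> in \<open>p - q\<close> is
  used to cancel \<open>t\<close> in \<open>p\<close> and in \<open>q\<close> separately. The
  coefficient at \<open>t\<close> is additive, so the two results differ by exactly
  \<open>r\<close>.\<close>

lemma red_diff:
  assumes "red star tord rord F (p - q) r"
  obtains p' q' where "(red star tord rord F)\<^sup>=\<^sup>= p p'" "(red star tord rord F)\<^sup>=\<^sup>= q q'" "r = p' - q'"
proof -
  from assms obtain t h where h: "reducer F t h" "Poly_Mapping.lookup h t = 1"
    "r = p - q - cmul (Poly_Mapping.lookup (p - q) t) h"
    by (rule red_normE)
  have "r = (p - cmul (Poly_Mapping.lookup p t) h) - (q - cmul (Poly_Mapping.lookup q t) h)"
    unfolding h(3) by (rule poly_mapping_eqI) (simp add: lookup_minus left_diff_distrib)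
  with red_step[OF h(1,2)] that show thesis by blast
qed

lemma diff_red_0_imp_joinable:
  assumes "(red star tord rord F)\<^sup>*\<^sup>* (p - q) 0"
  shows "\<exists>u. (red star tord rord F)\<^sup>*\<^sup>* p u \<and> (red star tord rord F)\<^sup>*\<^sup>* q u"
proof -
  \<comment> \<open>The difference is replaced by a variable \<open>d\<close> so that
    \<open>p\<close> and \<open>q\<close> may change along the chain from \<open>d\<close> to
    0.\<close>
  have "\<exists>u. (red star tord rord F)\<^sup>*\<^sup>* p u \<and> (red star tord rord F)\<^sup>*\<^sup>* q u"
    if "(red star tord rord F)\<^sup>*\<^sup>* d 0" "d = p - q" for d
    using that
  proof (induction arbitrary: p q rule: converse_rtranclp_induct)
    case base
    then show ?case by auto
  next
    case (step d e)
    then obtain p' q' where "(red star tord rord F)\<^sup>=\<^sup>= p p'" "(red star tord rord F)\<^sup>=\<^sup>= q q'"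
      "e = p' - q'"
      using red_diff by blast
    with step.IH show ?case by (metis r_into_rtranclp reflclp_idemp rtranclp_reflclp rtranclp_trans)
  qed
  with assms show ?thesis by blast
qed

text \<open>Supports, read as multisets, decrease in the multiset extension of the well-founded
  strict term order: a step removes \<open>t\<close> and can introduce only terms below
  \<open>t\<close>.\<close>

lemma wfP_red: "wfP (red star tord rord F)\<inverse>\<inverse>"
proof -
  have wf: "wf (tord - Id)" using tord_well_order by (simp add: well_order_on_def)
  let ?M = "\<lambda>p. mset_set (Poly_Mapping.keys p)"
  have "(?M q, ?M p) \<in> mult (tord - Id)" if pq: "red star tord rord F p q" for p q
  proof -
    from pq obtain t h where h: "reducer F t h"
      "Poly_Mapping.lookup h t = Poly_Mapping.lookup p t" and q: "q = p - h"
      by (auto simp: red_iff)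
    let ?P = "Poly_Mapping.keys p" and ?Q = "Poly_Mapping.keys q"
    have "Poly_Mapping.lookup p t \<noteq> 0" using h reducer_lookup_nonzero by metis
    with h q have t: "t \<in> ?P - ?Q" by (auto simp: in_keys_iff lookup_minus)
    have less: "(s, t) \<in> tord - Id" if "s \<in> ?Q - ?P" for s
    proof -
      \<comment> \<open>A term that is new in \<open>q\<close> must come from \<open>h\<close>,
        whose head term is \<open>t\<close>; it differs from \<open>t\<close> because
        \<open>t\<close> lies in the support of \<open>p\<close>.\<close>
      have "s \<in> Poly_Mapping.keys h" using that q by (auto simp: in_keys_iff lookup_minus)
      then show ?thesis
        using HT_greatest(2) reducer_HT_eq[OF h(1)] t that by (auto simp: HT_eq_def)
    qed
    \<comment> \<open>The common part of the supports is kept as context; the single element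
      \<open>t\<close> of \<open>?P - ?Q\<close> dominates all of \<open>?Q - ?P\<close>.\<close>
    have "(mset_set (?P \<inter> ?Q) + mset_set (?Q - ?P), mset_set (?P \<inter> ?Q) + mset_set (?P - ?Q))
      \<in> mult (tord - Id)"
    proof (rule one_step_implies_mult)
      show "mset_set (?P - ?Q) \<noteq> {#}" using t by (auto simp: mset_set_empty_iff)
      show "\<forall>k\<in>#mset_set (?Q - ?P). \<exists>j\<in>#mset_set (?P - ?Q). (k, j) \<in> tord - Id"
        using t less by auto
    qed
    also have "mset_set (?P \<inter> ?Q) + mset_set (?Q - ?P) = ?M q"
      by (subst mset_set_Union[symmetric]) (auto intro!: arg_cong[of _ _ mset_set])
    also have "mset_set (?P \<inter> ?Q) + mset_set (?P - ?Q) = ?M p"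
      by (subst mset_set_Union[symmetric]) (auto intro!: arg_cong[of _ _ mset_set])
    finally show ?thesis .
  qed
  then have "{(q, p). red star tord rord F p q} \<subseteq> inv_image (mult (tord - Id)) ?M"
    by auto
  then have "wf {(q, p). red star tord rord F p q}"
    by (rule wf_subset[OF wf_inv_image[OF wf_mult[OF wf]]])
  then show ?thesis by (simp add: wfp_def)
qed

subsection \<open>The generated ideal\<close>

lemma zero_in_ideal_gen: "0 \<in> ideal_gen star F"
  unfolding ideal_gen_def by (intro CollectI exI[of _ 0]) simp

lemma ideal_gen_add_generator:
  assumes "x \<in> ideal_gen star F" "f \<in> F"
  shows "x + g \<star> f \<star> h \<in> ideal_gen star F"
proof -
  from assms(1) obtain n :: nat and g' f' h' where
    x: "x = (\<Sum>i<n. g' i \<star> f' i \<star> h' i)" and f': "\<forall>i<n. f' i \<in> F"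
    by (auto simp: ideal_gen_def)
  \<comment> \<open>The new triple is stored at index \<open>n\<close>, which the first
    \<open>n\<close> summands never read.\<close>
  have "x + g \<star> f \<star> h = (\<Sum>i<Suc n. (g'(n := g)) i \<star> (f'(n := f)) i \<star> (h'(n := h)) i)"
    by (simp add: x)
  moreover have "\<forall>i<Suc n. (f'(n := f)) i \<in> F" using f' assms(2) by simp
  ultimately show ?thesis unfolding ideal_gen_def by blast
qed

lemma generator_in_ideal_gen: "f \<in> F \<Longrightarrow> g \<star> f \<star> h \<in> ideal_gen star F"
  using ideal_gen_add_generator[OF zero_in_ideal_gen] by simp

text \<open>A step may be traversed in either direction, adding \<open>h\<close> or
  \<open>- h\<close>; moving the sign into the left factor makes both multiples of a
  generator.\<close>

lemma reducerE:
  assumes "reducer F t h"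
  obtains f g l where "f \<in> F" "h = g \<star> f \<star> l" "- h = (- g) \<star> f \<star> l"
proof -
  from assms obtain f g l where "f \<in> F" "h = g \<star> f \<star> l" by (auto simp: reducer_def)
  moreover have "g \<star> f \<star> l + (- g) \<star> f \<star> l = 0"
    by (simp flip: star_distrib_right)
  ultimately show thesis using that by (simp add: minus_unique)
qed

lemma equivclp_red_imp_ideal:
  assumes "equivclp (red star tord rord F) p q"
  shows "p - q \<in> ideal_gen star F"
  using assms
proof (induction rule: equivclp_induct)
  case base
  show ?case by (simp add: zero_in_ideal_gen)
next
  case (step y z)
  from step.hyps(2) obtain t h where "reducer F t h" "p - z = (p - y) + h \<or> p - z = (p - y) + (- h)"
    by (auto simp: red_iff)
  with step.IH show ?case by (metis reducerE ideal_gen_add_generator)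
qed

text \<open>The hypothesis on monomial multiples is extended to arbitrary right factors, then to
  arbitrary left factors, then to finite sums. Each stage is phrased as \<open>?E (c + x) x\<close>
  for a summand \<open>c\<close> and arbitrary \<open>x\<close>, so that summands can be stripped
  off one at a time by transitivity.\<close>

lemma ideal_imp_equivclp_red:
  assumes multiples: "\<And>f m l. f \<in> F \<Longrightarrow> m \<in> monomials \<Longrightarrow> l \<in> monomials \<Longrightarrow>
      (red star tord rord F)\<^sup>*\<^sup>* (m \<star> f \<star> l) 0"
    and "p - q \<in> ideal_gen star F"
  shows "equivclp (red star tord rord F) p q"
proof -
  let ?E = "equivclp (red star tord rord F)"
  have trans: "?E x y \<Longrightarrow> ?E y z \<Longrightarrow> ?E x z" for x y z
    by (rule transpD[OF transp_equivclp])
  have joinable: "?E x y" if "(red star tord rord F)\<^sup>*\<^sup>* x u" "(red star tord rord F)\<^sup>*\<^sup>* y u" for x y u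
    using that rtranlcp_le_equivclp by (meson equivclp_sym predicate2D trans)
  \<comment> \<open>The two sides differ by \<open>m \<star> f \<star> l\<close>, which reduces to
    0, so they have a common reduct.\<close>
  have mono: "?E (m \<star> f \<star> l + x) x" if "f \<in> F" "m \<in> monomials" "l \<in> monomials" for f m l x
    using multiples[OF that] diff_red_0_imp_joinable[of F "m \<star> f \<star> l + x" x] joinable by auto
  \<comment> \<open>Monomials of the right factor are removed one by one, the remaining product
    joining the summand \<open>x\<close>. The nonzero coefficient supplied by the induction rule
    makes each \<open>single\<close> a monomial.\<close>
  have left: "?E (m \<star> f \<star> h + x) x" if "f \<in> F" "m \<in> monomials" for f m h x
  proof (induction h arbitrary: x rule: poly_mapping_single_add_induct)
    case zero
    show ?case by (simp add: equivclp_def)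
  next
    case (single_add a b h)
    then have "Poly_Mapping.single a b \<in> monomials" by (auto simp: monomials_eq)
    then show ?case
      using trans[OF mono[OF that, of _ "m \<star> f \<star> h + x"] single_add.IH]
      by (simp add: star_distrib_left add.assoc)
  qed
  have generator: "?E (g \<star> f \<star> h + x) x" if "f \<in> F" for f g h x
  proof (induction g arbitrary: x rule: poly_mapping_single_add_induct)
    case zero
    show ?case by (simp add: equivclp_def)
  next
    case (single_add a b g)
    then have "Poly_Mapping.single a b \<in> monomials" by (auto simp: monomials_eq)
    then show ?case
      using trans[OF left[OF that, of _ h "g \<star> f \<star> h + x"] single_add.IH]
      by (simp add: star_distrib_right add.assoc)
  qed
  have "?E ((\<Sum>i<n. g i \<star> f i \<star> h i) + q) q" if "\<forall>i<n. f i \<in> F" for n :: nat and g f h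
    using that
  proof (induction n)
    case 0
    show ?case by (simp add: equivclp_def)
  next
    case (Suc n)
    then have "?E (g n \<star> f n \<star> h n + ((\<Sum>i<n. g i \<star> f i \<star> h i) + q)) q"
      by (intro trans[OF generator]) simp_all
    then show ?case by (simp add: ac_simps)
  qed
  moreover from assms(2) obtain n :: nat and g f h
    where "p - q = (\<Sum>i<n. g i \<star> f i \<star> h i)" "\<forall>i<n. f i \<in> F"
    unfolding ideal_gen_def by blast
  ultimately have "?E (p - q + q) q" by metis
  then show ?thesis by simp
qed

text \<open>An ideal member is connected to 0, so by the Church-Rosser property it has a common
  reduct with 0; as 0 is irreducible, that reduct is 0 itself.\<close>

lemma groebner_basis_imp_red_0:
  assumes "groebner_basis star tord rord F" "p \<in> ideal_gen star F"
  shows "(red star tord rord F)\<^sup>*\<^sup>* p 0"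
proof -
  from assms have "equivclp (red star tord rord F) p 0" and "confluentp (red star tord rord F)"
    by (simp_all add: groebner_basis_def)
  then obtain u where u: "(red star tord rord F)\<^sup>*\<^sup>* p u" "(red star tord rord F)\<^sup>*\<^sup>* 0 u"
    by (auto simp: semiconfluentp_equivclp confluentp_eq_semiconfluentp rtranclp_conversep)
  have "\<not> red star tord rord F 0 v" for v by (simp add: red_def red1_def)
  with u(2) have "u = 0" by (metis converse_rtranclpE)
  with u(1) show ?thesis by simp
qed

subsection \<open>S-polynomials\<close>

lemma spol_in_ideal_gen:
  assumes "p \<in> F" "q \<in> F"
  shows "spol star tord p q (t, u1, u2, v1, v2) \<in> ideal_gen star F"
proof -
  \<comment> \<open>The normalising scalars and the minus sign are pushed into the left factors,
    giving a sum of two multiples of generators.\<close>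
  have "spol star tord p q (t, u1, u2, v1, v2) =
      cmul (inverse (HC tord (mon u1 \<star> p \<star> mon v1))) (mon u1) \<star> p \<star> mon v1 +
      cmul (- inverse (HC tord (mon u2 \<star> q \<star> mon v2))) (mon u2) \<star> q \<star> mon v2"
    by (rule poly_mapping_eqI) (simp add: spol_def cmul_star_left lookup_add lookup_minus)
  then show ?thesis
    by (simp add: ideal_gen_add_generator generator_in_ideal_gen assms)
qed

text \<open>The coefficients of the two monomial factors are absorbed by the normalisation.\<close>

lemma reducer_normE:
  assumes "reducer F t h"
  obtains f u v where "f \<in> F"
    "HT_eq tord (mon u \<star> mon (HT tord f) \<star> mon v) t" "HT_eq tord (mon u \<star> f \<star> mon v) t"
    "(HT tord f, t) \<in> rord"
    "h = cmul (Poly_Mapping.lookup h t)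
      (cmul (inverse (HC tord (mon u \<star> f \<star> mon v))) (mon u \<star> f \<star> mon v))"
proof -
  from assms obtain f m l where *: "f \<in> F" "f \<noteq> 0" "m \<in> monomials" "l \<in> monomials"
    "h = m \<star> f \<star> l" "HT_eq tord (m \<star> mon (HT tord f) \<star> l) t" "HT_eq tord h t" "(HT tord f, t) \<in> rord"
    by (auto simp: reducer_def)
  obtain a u where m: "a \<noteq> 0" "m = cmul a (mon u)" using *(3) by (rule monomialE)
  obtain b v where l: "b \<noteq> 0" "l = cmul b (mon v)" using *(4) by (rule monomialE)
  \<comment> \<open>Stated for every \<open>g\<close> because it serves both for \<open>f\<close>
    and for the monomial of its head term.\<close>
  have scale: "m \<star> g \<star> l = cmul (a * b) (mon u \<star> g \<star> mon v)" for g
    by (simp add: m l cmul_star_left cmul_star_right cmul_cmul mult.commute)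
  have h: "h = cmul (a * b) (mon u \<star> f \<star> mon v)" using *(5) scale by simp
  have ht: "HT_eq tord (mon u \<star> f \<star> mon v) t" "HT_eq tord (mon u \<star> mon (HT tord f) \<star> mon v) t"
    using *(6,7) m(1) l(1) by (simp_all add: h scale HT_eq_cmul)
  have "HC tord (mon u \<star> f \<star> mon v) \<noteq> 0" "HC tord (mon u \<star> f \<star> mon v) = Poly_Mapping.lookup (mon u \<star> f \<star> mon v) t"
    using HT_eq_imp_lookup_nonzero[OF ht(1)] ht(1) by (simp_all add: HC_def HT_eq_def)
  then have "h = cmul (Poly_Mapping.lookup h t)
      (cmul (inverse (HC tord (mon u \<star> f \<star> mon v))) (mon u \<star> f \<star> mon v))"
    by (simp add: h cmul_cmul mult.assoc)
  with * ht that show thesis by blast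
qed

text \<open>Both multiples are the same scalar times a normalised product of a generator with terms.
  Factoring out that scalar leaves an s-polynomial, and scaling preserves reducibility to 0.\<close>

lemma diff_reducers_same_term:
  assumes spols: "\<And>p q t u1 u2 v1 v2. p \<in> F \<Longrightarrow> q \<in> F \<Longrightarrow>
      (t, u1, u2, v1, v2) \<in> critical_tuples star tord rord p q \<Longrightarrow>
      (red star tord rord F)\<^sup>*\<^sup>* (spol star tord p q (t, u1, u2, v1, v2)) 0"
    and h: "reducer F t h1" "reducer F t h2" "Poly_Mapping.lookup h1 t = Poly_Mapping.lookup h2 t"
  shows "(red star tord rord F)\<^sup>*\<^sup>* (h1 - h2) 0"
proof -
  obtain p u1 v1 where p: "p \<in> F" "HT_eq tord (mon u1 \<star> mon (HT tord p) \<star> mon v1) t"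
    "HT_eq tord (mon u1 \<star> p \<star> mon v1) t" "(HT tord p, t) \<in> rord"
    and h1: "h1 = cmul (Poly_Mapping.lookup h1 t)
      (cmul (inverse (HC tord (mon u1 \<star> p \<star> mon v1))) (mon u1 \<star> p \<star> mon v1))"
    using h(1) by (rule reducer_normE)
  obtain q u2 v2 where q: "q \<in> F" "HT_eq tord (mon u2 \<star> mon (HT tord q) \<star> mon v2) t"
    "HT_eq tord (mon u2 \<star> q \<star> mon v2) t" "(HT tord q, t) \<in> rord"
    and h2: "h2 = cmul (Poly_Mapping.lookup h2 t)
      (cmul (inverse (HC tord (mon u2 \<star> q \<star> mon v2))) (mon u2 \<star> q \<star> mon v2))"
    using h(2) by (rule reducer_normE)
  have "h1 - h2 = cmul (Poly_Mapping.lookup h1 t) (spol star tord p q (t, u1, u2, v1, v2))"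
    unfolding spol_def prod.case cmul_diff using h1 h2 h(3) by metis
  moreover have "(t, u1, u2, v1, v2) \<in> critical_tuples star tord rord p q"
    using p q by (simp add: critical_tuples_def)
  ultimately show ?thesis using spols[OF p(1) q(1)] by (simp add: rtranclp_red_cmul_0)
qed

text \<open>Two steps suffice: \<open>h\<close> cancels itself in \<open>h - g\<close>, since its
  head term does not occur in \<open>g\<close>, and then \<open>- g\<close> is removed by itself.
  The other sign follows by scaling with -1.\<close>

lemma diff_reducers_less:
  assumes h: "reducer F t h" "reducer F s g" and less: "(s, t) \<in> tord - Id"
  shows "(red star tord rord F)\<^sup>*\<^sup>* (h - g) 0" and "(red star tord rord F)\<^sup>*\<^sup>* (g - h) 0"
proof -
  have "antisym tord"
    using tord_well_order by (auto simp: order_on_defs well_order_on_def)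
  then have "t \<notin> Poly_Mapping.keys g"
    using reducer_HT_eq[OF h(2)] HT_greatest(2)[of g t] less by (auto simp: HT_eq_def antisym_def)
  then have g_t: "Poly_Mapping.lookup g t = 0" by (simp add: in_keys_iff)
  have neg: "cmul (- 1) x = - x" for x :: "'t \<Rightarrow>\<^sub>0 'k"
    by (rule poly_mapping_eqI) simp
  have "red star tord rord F (h - g) (- g)"
    unfolding red_iff using h(1) g_t by (intro exI[of _ t] exI[of _ h]) (simp add: lookup_minus)
  moreover have "red star tord rord F (- g) 0"
    using reducer_red_0[OF reducer_cmul[OF h(2), of "- 1"]] by (simp add: neg)
  ultimately show *: "(red star tord rord F)\<^sup>*\<^sup>* (h - g) 0" by auto
  show "(red star tord rord F)\<^sup>*\<^sup>* (g - h) 0"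
    using rtranclp_red_cmul_0[OF *, of "- 1"] by (simp add: neg)
qed

text \<open>By Newman's lemma only local forks matter. The targets of a fork from \<open>p\<close>
  satisfy \<open>p1 - p2 = h2 - h1\<close>, so it is enough that this difference reduces to 0;
  s-polynomials enter only when both steps cancel the same term.\<close>

lemma confluentp_red:
  assumes spols: "\<And>p q t u1 u2 v1 v2. p \<in> F \<Longrightarrow> q \<in> F \<Longrightarrow>
      (t, u1, u2, v1, v2) \<in> critical_tuples star tord rord p q \<Longrightarrow>
      (red star tord rord F)\<^sup>*\<^sup>* (spol star tord p q (t, u1, u2, v1, v2)) 0"
  shows "confluentp (red star tord rord F)"
proof (rule newman[OF wfP_red])
  fix p p1 p2
  assume "red star tord rord F p p1" "red star tord rord F p p2"
  then obtain t1 h1 t2 h2 where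
    h1: "reducer F t1 h1" "Poly_Mapping.lookup h1 t1 = Poly_Mapping.lookup p t1" "p1 = p - h1" and
    h2: "reducer F t2 h2" "Poly_Mapping.lookup h2 t2 = Poly_Mapping.lookup p t2" "p2 = p - h2"
    by (auto simp: red_iff)
  have "total tord" using tord_well_order by (auto simp: order_on_defs well_order_on_def)
  then consider "t1 = t2" | "(t1, t2) \<in> tord - Id" | "(t2, t1) \<in> tord - Id"
    by (auto simp: total_on_def)
  then have "(red star tord rord F)\<^sup>*\<^sup>* (h2 - h1) 0"
  proof cases
    case 1
    show ?thesis
    proof (rule diff_reducers_same_term[of F t1])
      show "reducer F t1 h2" "reducer F t1 h1"
        "Poly_Mapping.lookup h2 t1 = Poly_Mapping.lookup h1 t1" using 1 h1 h2 by simp_all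
    qed (rule spols)
  next
    case 2
    then show ?thesis using diff_reducers_less(1) h1(1) h2(1) by blast
  next
    case 3
    then show ?thesis using diff_reducers_less(2) h1(1) h2(1) by blast
  qed
  then have "(red star tord rord F)\<^sup>*\<^sup>* (p1 - p2) 0" by (simp add: h1 h2)
  then show "\<exists>u. (red star tord rord F)\<^sup>*\<^sup>* p1 u \<and> (red star tord rord F)\<^sup>*\<^sup>* p2 u"
    by (rule diff_red_0_imp_joinable)
qed

end

theorem theorem4p4p23:
  fixes star :: "('t \<Rightarrow>\<^sub>0 'k::field) \<Rightarrow> ('t \<Rightarrow>\<^sub>0 'k) \<Rightarrow> ('t \<Rightarrow>\<^sub>0 'k)" (infixl \<open>\<star>\<close> 70)
    and tord rord :: "'t rel"
    and F :: "('t \<Rightarrow>\<^sub>0 'k) set"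
  assumes "reductive_function_ring star tord rord"
    and "0 \<notin> F"
  shows "groebner_basis star tord rord F \<longleftrightarrow>
    (\<forall>f \<in> F. \<forall>m \<in> monomials. \<forall>l \<in> monomials.
       (red star tord rord F)\<^sup>*\<^sup>* (m \<star> f \<star> l) 0) \<and>
    (\<forall>p \<in> F. \<forall>q \<in> F. \<forall>(t, u1, u2, v1, v2) \<in> critical_tuples star tord rord p q.
       (red star tord rord F)\<^sup>*\<^sup>* (spol star tord p q (t, u1, u2, v1, v2)) 0)"
    (is "?G \<longleftrightarrow> ?multiples \<and> ?spols")
proof -
  interpret reductive_function_ring star tord rord by (fact assms(1))
  show ?thesis
  proof
    assume ?G
    then show "?multiples \<and> ?spols"
      \<comment> \<open>Monomial multiples of generators and s-polynomials all lie in the ideal,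
        whose members reduce to 0.\<close>
      by (auto intro!: groebner_basis_imp_red_0 generator_in_ideal_gen spol_in_ideal_gen)
  next
    assume conditions: "?multiples \<and> ?spols"
    \<comment> \<open>The conditions are used separately: the one on s-polynomials gives confluence,
      the one on monomial multiples gives the inclusion of the ideal congruence in the reduction
      equivalence. The reverse inclusion holds for every \<open>F\<close>.\<close>
    have "confluentp (red star tord rord F)"
    proof (rule confluentp_red)
      fix p q t u1 u2 v1 v2
      assume "p \<in> F" "q \<in> F" "(t, u1, u2, v1, v2) \<in> critical_tuples star tord rord p q"
      then show "(red star tord rord F)\<^sup>*\<^sup>* (spol star tord p q (t, u1, u2, v1, v2)) 0"
        using conditions by fast
    qed
    moreover have "equivclp (red star tord rord F) f g \<longleftrightarrow> f - g \<in> ideal_gen star F" for f g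
    proof
      assume "f - g \<in> ideal_gen star F"
      then show "equivclp (red star tord rord F) f g"
        by (rule ideal_imp_equivclp_red[rotated]) (simp add: conditions)
    qed (rule equivclp_red_imp_ideal)
    ultimately show ?G by (simp add: groebner_basis_def)
  qed
qed

end
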